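(* Let $\mathbf{k}$ be a field of characteristic $0$ and let $A$ be a vector space over $\mathbf{k}$ with two binary operations $\cdot$ and $\circ$. Define two binary operations $\cdot$ and $[\cdot,\cdot]$ on $A[t,t^{-1}]:=A\otimes\mathbf{k}[t,t^{-1}]$ by $$(xt^m)\cdot(yt^n)=(x\cdot y)t^{m+n},\qquad [xt^m,yt^n]=m(x\circ y)t^{m+n-1}-n(y\circ x)t^{m+n-1}$$ for all $x,y\in A$ and $m,n\in\mathbb{Z}$, where $xt^m:=x\otimes t^m$. Then $(A[t,t^{-1}],\cdot,[\cdot,\cdot])$ is a transposed Poisson algebra if and only if $(A,\cdot,\circ)$ is a transposed Novikov-Poisson algebra.
   Context: All binary operations are $\mathbf{k}$-bilinear. A (left) Novikov algebra $(A,\circ)$ is a vector space with a binary operation satisfying $(x\circ y)\circ z=(x\circ z)\circ y$ and $(x\circ y)\circ z-x\circ(y\circ z)=(y\circ x)\circ z-y\circ(x\circ z)$ for all $x,y,z$. A transposed Novikov-Poisson algebra is a triple $(A,\cdot,\circ)$ where $(A,\cdot)$ is a commutative associative algebra (not necessarily unital), $(A,\circ)$ is a Novikov algebra, and for all $x,y,z\in A$: $(x\cdot y)\circ z=(x\cdot z)\circ y$ and $2z\cdot(x\circ y)=(z\cdot x)\circ y+x\circ(z\cdot y)$. A transposed Poisson algebra is a triple $(L,\cdot,[\cdot,\cdot])$ where $(L,\cdot)$ is a commutative associative algebra, $(L,[\cdot,\cdot])$ is a Lie algebra, and $2z\cdot[x,y]=[z\cdot x,y]+[x,z\cdot y]$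 for all $x,y,z\in L$. *)

theory Defs
  imports Complex_Main "HOL-Library.Poly_Mapping"
begin

definition bilinear_map ::
  "('k::field \<Rightarrow> 'a::ab_group_add \<Rightarrow> 'a) \<Rightarrow> ('k \<Rightarrow> 'b::ab_group_add \<Rightarrow> 'b) \<Rightarrow>
   ('k \<Rightarrow> 'c::ab_group_add \<Rightarrow> 'c) \<Rightarrow> ('a \<Rightarrow> 'b \<Rightarrow> 'c) \<Rightarrow> bool"
  where "bilinear_map s1 s2 s3 \<beta> \<longleftrightarrow>
    (\<forall>y. Vector_Spaces.linear s1 s3 (\<lambda>x. \<beta> x y)) \<and> (\<forall>x. Vector_Spaces.linear s2 s3 (\<beta> x))"

locale k_algebra = vector_space scale
  for scale :: "'k::field \<Rightarrow> 'a::ab_group_add \<Rightarrow> 'a" (infixr \<open>*s\<close> 75)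
    and mul :: "'a \<Rightarrow> 'a \<Rightarrow> 'a" +
  assumes bilinear: "bilinear_map scale scale scale mul"

locale comm_assoc_algebra = k_algebra scale mul
  for scale :: "'k::field \<Rightarrow> 'a::ab_group_add \<Rightarrow> 'a" (infixr \<open>*s\<close> 75)
    and mul :: "'a \<Rightarrow> 'a \<Rightarrow> 'a" (infixl \<open>\<cdot>\<close> 70) +
  assumes commutative: "x \<cdot> y = y \<cdot> x"
    and associative: "(x \<cdot> y) \<cdot> z = x \<cdot> (y \<cdot> z)"

locale lie_algebra = k_algebra scale bracket
  for scale :: "'k::field \<Rightarrow> 'a::ab_group_add \<Rightarrow> 'a" (infixr \<open>*s\<close> 75)
    and bracket :: "'a \<Rightarrow> 'a \<Rightarrow> 'a" +
  assumes alternating: "bracket x x = 0"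
    and jacobi: "bracket x (bracket y z) + bracket y (bracket z x) + bracket z (bracket x y) = 0"

locale novikov_algebra = k_algebra scale circ
  for scale :: "'k::field \<Rightarrow> 'a::ab_group_add \<Rightarrow> 'a" (infixr \<open>*s\<close> 75)
    and circ :: "'a \<Rightarrow> 'a \<Rightarrow> 'a" (infixl \<open>\<star>\<close> 70) +
  assumes right_commutative: "(x \<star> y) \<star> z = (x \<star> z) \<star> y"
    and left_symmetric: "(x \<star> y) \<star> z - x \<star> (y \<star> z) = (y \<star> x) \<star> z - y \<star> (x \<star> z)"

locale transposed_novikov_poisson_algebra =
  comm_assoc_algebra scale mul + novikov_algebra scale circ
  for scale :: "'k::field \<Rightarrow> 'a::ab_group_add \<Rightarrow> 'a" (infixr \<open>*s\<close> 75)
    and mul :: "'a \<Rightarrow> 'a \<Rightarrow> 'a" (infixl \<open>\<cdot>\<close> 70)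
    and circ :: "'a \<Rightarrow> 'a \<Rightarrow> 'a" (infixl \<open>\<star>\<close> 70) +
  assumes mul_circ_commute: "(x \<cdot> y) \<star> z = (x \<cdot> z) \<star> y"
    and mul_circ_leibniz: "2 *s (z \<cdot> (x \<star> y)) = (z \<cdot> x) \<star> y + x \<star> (z \<cdot> y)"

locale transposed_poisson_algebra =
  comm_assoc_algebra scale mul + lie_algebra scale bracket
  for scale :: "'k::field \<Rightarrow> 'a::ab_group_add \<Rightarrow> 'a" (infixr \<open>*s\<close> 75)
    and mul :: "'a \<Rightarrow> 'a \<Rightarrow> 'a" (infixl \<open>\<cdot>\<close> 70)
    and bracket :: "'a \<Rightarrow> 'a \<Rightarrow> 'a" +
  assumes mul_bracket_leibniz:
    "2 *s (z \<cdot> bracket x y) = bracket (z \<cdot> x) y + bracket x (z \<cdot> y)"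

text \<open>
  The Laurent polynomials \<open>k[t, t\<^sup>-\<^sup>1]\<close> are the finitely supported functions \<open>int \<Rightarrow>\<^sub>0 'k\<close>, with
  \<open>t\<^sup>m = Poly_Mapping.single m 1\<close>. The tensor product with \<open>A\<close> is modelled by \<open>int \<Rightarrow>\<^sub>0 'a\<close>,
  where \<open>x \<otimes> p\<close> has the coefficients \<open>p\<^sub>m x\<close>; the lemmas \<open>bilinear_laurent_tensor\<close> and
  \<open>laurent_tensor_universal\<close> below show that this is a tensor product.
\<close>

definition laurent_scale ::
  "('k::field \<Rightarrow> 'a::ab_group_add \<Rightarrow> 'a) \<Rightarrow> 'k \<Rightarrow> (int \<Rightarrow>\<^sub>0 'a) \<Rightarrow> (int \<Rightarrow>\<^sub>0 'a)"
  where "laurent_scale scale c = Poly_Mapping.map (scale c)"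

definition laurent_tensor ::
  "('k::field \<Rightarrow> 'a::ab_group_add \<Rightarrow> 'a) \<Rightarrow> 'a \<Rightarrow> (int \<Rightarrow>\<^sub>0 'k) \<Rightarrow> (int \<Rightarrow>\<^sub>0 'a)"
  where "laurent_tensor scale x p = Poly_Mapping.map (\<lambda>c. scale c x) p"

definition laurent_monom ::
  "('k::field \<Rightarrow> 'a::ab_group_add \<Rightarrow> 'a) \<Rightarrow> 'a \<Rightarrow> int \<Rightarrow> (int \<Rightarrow>\<^sub>0 'a)"
  where "laurent_monom scale x m = laurent_tensor scale x (Poly_Mapping.single m 1)"

text \<open>
  The biadditive extension to \<open>A[t, t\<^sup>-\<^sup>1]\<close> of the rule \<open>(x t\<^sup>m, y t\<^sup>n) \<mapsto> \<phi> x m y n\<close>, where \<open>\<phi>\<close> is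
  biadditive in \<open>x\<close> and \<open>y\<close>.  See \<open>bilinear_laurent_mul\<close>, \<open>laurent_mul_monom\<close>,
  \<open>bilinear_laurent_bracket\<close> and \<open>laurent_bracket_monom\<close> for its two uses.
\<close>

definition laurent_extend ::
  "('a::ab_group_add \<Rightarrow> int \<Rightarrow> 'a \<Rightarrow> int \<Rightarrow> (int \<Rightarrow>\<^sub>0 'a)) \<Rightarrow>
   (int \<Rightarrow>\<^sub>0 'a) \<Rightarrow> (int \<Rightarrow>\<^sub>0 'a) \<Rightarrow> (int \<Rightarrow>\<^sub>0 'a)"
  where "laurent_extend \<phi> f g =
    (\<Sum>m\<in>Poly_Mapping.keys f. \<Sum>n\<in>Poly_Mapping.keys g.
      \<phi> (Poly_Mapping.lookup f m) m (Poly_Mapping.lookup g n) n)"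

definition laurent_mul ::
  "('k::field \<Rightarrow> 'a::ab_group_add \<Rightarrow> 'a) \<Rightarrow> ('a \<Rightarrow> 'a \<Rightarrow> 'a) \<Rightarrow>
   (int \<Rightarrow>\<^sub>0 'a) \<Rightarrow> (int \<Rightarrow>\<^sub>0 'a) \<Rightarrow> (int \<Rightarrow>\<^sub>0 'a)"
  where "laurent_mul scale mul =
    laurent_extend (\<lambda>x m y n. laurent_monom scale (mul x y) (m + n))"

definition laurent_bracket ::
  "('k::field \<Rightarrow> 'a::ab_group_add \<Rightarrow> 'a) \<Rightarrow> ('a \<Rightarrow> 'a \<Rightarrow> 'a) \<Rightarrow>
   (int \<Rightarrow>\<^sub>0 'a) \<Rightarrow> (int \<Rightarrow>\<^sub>0 'a) \<Rightarrow> (int \<Rightarrow>\<^sub>0 'a)"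
  where "laurent_bracket scale circ =
    laurent_extend (\<lambda>x m y n.
      laurent_scale scale (of_int m) (laurent_monom scale (circ x y) (m + n - 1))
      - laurent_scale scale (of_int n) (laurent_monom scale (circ y x) (m + n - 1)))"

lemma bilinear_mapD:
  assumes "bilinear_map s1 s2 s3 \<beta>"
  shows "\<beta> (x + x') y = \<beta> x y + \<beta> x' y" "\<beta> x (y + y') = \<beta> x y + \<beta> x y'"
    "\<beta> (s1 c x) y = s3 c (\<beta> x y)" "\<beta> x (s2 c y) = s3 c (\<beta> x y)"
    "\<beta> 0 y = 0" "\<beta> x 0 = 0"
proof -
  have l: "Vector_Spaces.linear s1 s3 (\<lambda>x. \<beta> x y)" and r: "Vector_Spaces.linear s2 s3 (\<beta> x)" for x y
    using assms by (auto simp: bilinear_map_def)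
  interpret l: Vector_Spaces.linear s1 s3 "\<lambda>x. \<beta> x y" by (rule l)
  interpret r: Vector_Spaces.linear s2 s3 "\<beta> x" by (rule r)
  show "\<beta> (x + x') y = \<beta> x y + \<beta> x' y" "\<beta> x (y + y') = \<beta> x y + \<beta> x y'"
    "\<beta> (s1 c x) y = s3 c (\<beta> x y)" "\<beta> x (s2 c y) = s3 c (\<beta> x y)"
    "\<beta> 0 y = 0" "\<beta> x 0 = 0"
    by (simp_all add: l.add r.add l.scale r.scale l.zero r.zero)
qed

lemma linearI:
  assumes "vector_space s1" "vector_space s2"
    and "\<And>x y. f (x + y) = f x + f y" "\<And>c x. f (s1 c x) = s2 c (f x)"
  shows "Vector_Spaces.linear s1 s2 f"
  using assms
  by (simp add: Vector_Spaces.linear_def module_hom_def module_hom_axioms_def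
      module_iff_vector_space)

lemma sum_keys_eq_sum_superset:
  assumes "finite S" "Poly_Mapping.keys f \<subseteq> S" "\<And>m. h 0 m = (0::'b::comm_monoid_add)"
  shows "(\<Sum>m\<in>Poly_Mapping.keys f. h (Poly_Mapping.lookup f m) m)
    = (\<Sum>m\<in>S. h (Poly_Mapping.lookup f m) m)"
  using assms by (intro sum.mono_neutral_left) (auto simp: in_keys_iff)

lemma sum_keys_add:
  assumes "\<And>m. h 0 m = (0::'b::comm_monoid_add)" "\<And>x y m. h (x + y) m = h x m + h y m"
  shows "(\<Sum>m\<in>Poly_Mapping.keys (f + g). h (Poly_Mapping.lookup (f + g) m) m)
    = (\<Sum>m\<in>Poly_Mapping.keys f. h (Poly_Mapping.lookup f m) m)
      + (\<Sum>m\<in>Poly_Mapping.keys g. h (Poly_Mapping.lookup g m) m)"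
proof -
  let ?S = "Poly_Mapping.keys f \<union> Poly_Mapping.keys g"
  have "Poly_Mapping.keys (f + g) \<subseteq> ?S" by (rule Poly_Mapping.keys_add)
  then have "(\<Sum>m\<in>Poly_Mapping.keys (f + g). h (Poly_Mapping.lookup (f + g) m) m)
      = (\<Sum>m\<in>?S. h (Poly_Mapping.lookup (f + g) m) m)"
    by (intro sum_keys_eq_sum_superset assms) auto
  moreover have "(\<Sum>m\<in>Poly_Mapping.keys f. h (Poly_Mapping.lookup f m) m)
      = (\<Sum>m\<in>?S. h (Poly_Mapping.lookup f m) m)"
    by (intro sum_keys_eq_sum_superset assms) auto
  moreover have "(\<Sum>m\<in>Poly_Mapping.keys g. h (Poly_Mapping.lookup g m) m)
      = (\<Sum>m\<in>?S. h (Poly_Mapping.lookup g m) m)"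
    by (intro sum_keys_eq_sum_superset assms) auto
  ultimately show ?thesis
    by (simp only: lookup_add assms(2) sum.distrib)
qed

context vector_space
begin

lemma lookup_laurent_scale [simp]:
  "Poly_Mapping.lookup (laurent_scale scale c f) m = scale c (Poly_Mapping.lookup f m)"
  by (simp add: laurent_scale_def Poly_Mapping.map.rep_eq when_def)

lemma lookup_laurent_tensor [simp]:
  "Poly_Mapping.lookup (laurent_tensor scale x p) m = scale (Poly_Mapping.lookup p m) x"
  by (simp add: laurent_tensor_def Poly_Mapping.map.rep_eq when_def)

lemma laurent_monom_eq_single: "laurent_monom scale x m = Poly_Mapping.single m x"
  by (rule poly_mapping_eqI) (simp add: laurent_monom_def lookup_single when_def)

lemma vector_space_laurent_scale: "vector_space (laurent_scale scale)"
  by unfold_locales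
    (auto intro!: poly_mapping_eqI simp: lookup_add scale_right_distrib scale_left_distrib)

lemma vector_space_laurent_poly:
  "vector_space (laurent_scale ((*) :: 'a \<Rightarrow> 'a \<Rightarrow> 'a))"
proof -
  interpret k: vector_space "(*) :: 'a \<Rightarrow> 'a \<Rightarrow> 'a"
    by unfold_locales (auto simp: algebra_simps)
  show ?thesis by (rule k.vector_space_laurent_scale)
qed

lemma bilinear_laurent_tensor:
  "bilinear_map scale (laurent_scale (*)) (laurent_scale scale) (laurent_tensor scale)"
proof -
  interpret k: vector_space "(*) :: 'a \<Rightarrow> 'a \<Rightarrow> 'a"
    by unfold_locales (auto simp: algebra_simps)
  show ?thesis
    unfolding bilinear_map_def
    by (auto intro!: linearI vector_space_laurent_scale vector_space_laurent_poly poly_mapping_eqI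
        vector_space_axioms simp: lookup_add scale_right_distrib scale_left_distrib mult.commute)
qed

lemma poly_mapping_sum_single:
  "(\<Sum>m\<in>Poly_Mapping.keys f. Poly_Mapping.single m (Poly_Mapping.lookup f m)) = f"
  by (rule poly_mapping_eqI) (auto simp: lookup_sum lookup_single when_def in_keys_iff)

lemma laurent_tensor_universal:
  fixes s3 :: "'a \<Rightarrow> 'c::ab_group_add \<Rightarrow> 'c"
  assumes "bilinear_map scale (laurent_scale (*)) s3 \<beta>"
  shows "\<exists>!F. Vector_Spaces.linear (laurent_scale scale) s3 F \<and>
    (\<forall>x p. F (laurent_tensor scale x p) = \<beta> x p)"
proof -
  interpret k: vector_space "(*) :: 'a \<Rightarrow> 'a \<Rightarrow> 'a"
    by unfold_locales (auto simp: algebra_simps)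
  have "Vector_Spaces.linear scale s3 (\<lambda>x. \<beta> x 0)"
    using assms by (auto simp: bilinear_map_def)
  then have vs3: "vector_space s3"
    by (simp add: Vector_Spaces.linear_def)
  then interpret w: vector_space s3 .
  note b = bilinear_mapD[OF assms]
  define F where "F f = (\<Sum>m\<in>Poly_Mapping.keys f.
    \<beta> (Poly_Mapping.lookup f m) (Poly_Mapping.single m 1))" for f
  have Fscale: "F (laurent_scale scale c f) = s3 c (F f)" for c f
  proof -
    have "Poly_Mapping.keys (laurent_scale scale c f) \<subseteq> Poly_Mapping.keys f"
      by (auto simp: in_keys_iff)
    then have "F (laurent_scale scale c f) = (\<Sum>m\<in>Poly_Mapping.keys f.
        \<beta> (Poly_Mapping.lookup (laurent_scale scale c f) m) (Poly_Mapping.single m 1))"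
      unfolding F_def
      by (intro sum_keys_eq_sum_superset[where h = "\<lambda>x m. \<beta> x (Poly_Mapping.single m 1)"])
        (auto simp: b)
    also have "\<dots> = s3 c (F f)" by (simp add: F_def b w.scale_sum_right)
    finally show ?thesis .
  qed
  have Fadd: "F (f + g) = F f + F g" for f g
    unfolding F_def
    by (rule sum_keys_add[where h = "\<lambda>x m. \<beta> x (Poly_Mapping.single m 1)"]) (auto simp: b)
  have Flin: "Vector_Spaces.linear (laurent_scale scale) s3 F"
    by (intro linearI vector_space_laurent_scale vs3 Fadd Fscale)
  have bsum: "\<beta> x (\<Sum>m\<in>S. q m) = (\<Sum>m\<in>S. \<beta> x (q m))" for x and S :: "int set" and q
    by (induction S rule: infinite_finite_induct) (auto simp: b)
  have Ftens: "F (laurent_tensor scale x p) = \<beta> x p" for x p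
  proof -
    have sing: "Poly_Mapping.single m c = laurent_scale (*) c (Poly_Mapping.single m 1)"
      for m :: int and c :: 'a
      by (rule poly_mapping_eqI) (simp add: lookup_single when_def)
    have "Poly_Mapping.keys (laurent_tensor scale x p) \<subseteq> Poly_Mapping.keys p"
      by (auto simp: in_keys_iff)
    then have "F (laurent_tensor scale x p) = (\<Sum>m\<in>Poly_Mapping.keys p.
        \<beta> (Poly_Mapping.lookup (laurent_tensor scale x p) m) (Poly_Mapping.single m 1))"
      unfolding F_def
      by (intro sum_keys_eq_sum_superset[where h = "\<lambda>x m. \<beta> x (Poly_Mapping.single m 1)"])
        (auto simp: b)
    also have "\<dots> = (\<Sum>m\<in>Poly_Mapping.keys p.
        \<beta> x (Poly_Mapping.single m (Poly_Mapping.lookup p m)))"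
      by (intro sum.cong refl, subst sing) (simp add: b)
    also have "\<dots> = \<beta> x p"
      by (simp only: bsum[symmetric] poly_mapping_sum_single)
    finally show ?thesis .
  qed
  show ?thesis
  proof (rule ex1I[of _ F])
    show "Vector_Spaces.linear (laurent_scale scale) s3 F \<and>
        (\<forall>x p. F (laurent_tensor scale x p) = \<beta> x p)"
      using Flin Ftens by blast
  next
    fix G
    assume G: "Vector_Spaces.linear (laurent_scale scale) s3 G \<and>
        (\<forall>x p. G (laurent_tensor scale x p) = \<beta> x p)"
    then interpret G: Vector_Spaces.linear "laurent_scale scale" s3 G by blast
    show "G = F"
    proof
      fix f
      have "G f = G (\<Sum>m\<in>Poly_Mapping.keys f. laurent_monom scale (Poly_Mapping.lookup f m) m)"
        by (simp add: laurent_monom_eq_single poly_mapping_sum_single)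
      also have "\<dots> = F f"
        using G by (simp add: G.sum F_def laurent_monom_def)
      finally show "G f = F f" .
    qed
  qed
qed

end

lemma laurent_extend_single:
  assumes "\<And>m y n. \<phi> 0 m y n = 0" "\<And>x m n. \<phi> x m 0 n = 0"
  shows "laurent_extend \<phi> (Poly_Mapping.single m x) (Poly_Mapping.single n y) = \<phi> x m y n"
  using assms by (simp add: laurent_extend_def)

lemma laurent_extend_bilinear:
  assumes "vector_space scale"
    and add: "\<And>x x' m y n. \<phi> (x + x') m y n = \<phi> x m y n + \<phi> x' m y n"
      "\<And>x m y y' n. \<phi> x m (y + y') n = \<phi> x m y n + \<phi> x m y' n"
    and sc: "\<And>c x m y n. \<phi> (scale c x) m y n = laurent_scale scale c (\<phi> x m y n)"
      "\<And>c x m y n. \<phi> x m (scale c y) n = laurent_scale scale c (\<phi> x m y n)"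
  shows "bilinear_map (laurent_scale scale) (laurent_scale scale) (laurent_scale scale)
    (laurent_extend \<phi>)"
proof -
  interpret vector_space scale by fact
  interpret l: vector_space "laurent_scale scale" by (rule vector_space_laurent_scale)
  have z: "\<phi> 0 m y n = 0" "\<phi> x m 0 n = 0" for x m y n
    using add(1)[of 0 0 m y n] add(2)[of x m 0 0 n] by simp_all
  have swap: "laurent_extend \<phi> f g = laurent_extend (\<lambda>y n x m. \<phi> x m y n) g f" for f g
    unfolding laurent_extend_def by (rule sum.swap)
  have A: "laurent_extend \<psi> (f + f') g = laurent_extend \<psi> f g + laurent_extend \<psi> f' g"
    if "\<And>x x' m y n. \<psi> (x + x') m y n = \<psi> x m y n + \<psi> x' m y n" "\<And>m y n. \<psi> 0 m y n = 0"
    for \<psi> :: "'b \<Rightarrow> int \<Rightarrow> 'b \<Rightarrow> int \<Rightarrow> (int \<Rightarrow>\<^sub>0 'b)" and f f' g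
    unfolding laurent_extend_def
    by (rule sum_keys_add[where h = "\<lambda>x m. \<Sum>n\<in>Poly_Mapping.keys g.
        \<psi> x m (Poly_Mapping.lookup g n) n"]) (simp_all add: that sum.distrib)
  have S: "laurent_extend \<psi> (laurent_scale scale c f) g
      = laurent_scale scale c (laurent_extend \<psi> f g)"
    if "\<And>c x m y n. \<psi> (scale c x) m y n = laurent_scale scale c (\<psi> x m y n)"
      "\<And>m y n. \<psi> 0 m y n = 0"
    for \<psi> :: "'b \<Rightarrow> int \<Rightarrow> 'b \<Rightarrow> int \<Rightarrow> (int \<Rightarrow>\<^sub>0 'b)" and c f g
  proof -
    have "Poly_Mapping.keys (laurent_scale scale c f) \<subseteq> Poly_Mapping.keys f"
      by (auto simp: in_keys_iff)
    then show ?thesis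
      unfolding laurent_extend_def
      by (subst sum_keys_eq_sum_superset[where S = "Poly_Mapping.keys f" and
            h = "\<lambda>x m. \<Sum>n\<in>Poly_Mapping.keys g. \<psi> x m (Poly_Mapping.lookup g n) n"])
        (simp_all add: that l.scale_sum_right)
  qed
  show ?thesis
    unfolding bilinear_map_def
  proof (intro conjI allI)
    show "Vector_Spaces.linear (laurent_scale scale) (laurent_scale scale)
        (\<lambda>f. laurent_extend \<phi> f g)" for g
      by (intro linearI vector_space_laurent_scale A S) (simp_all add: add sc z)
    show "Vector_Spaces.linear (laurent_scale scale) (laurent_scale scale) (laurent_extend \<phi> f)" for f
      unfolding swap[of f]
      by (intro linearI vector_space_laurent_scale A S) (simp_all add: add sc z)
  qed
qed

context k_algebra
begin

lemmas mul_simps = bilinear_mapD[OF bilinear]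

lemma laurent_mul_monom:
  "laurent_mul scale mul (laurent_monom scale x m) (laurent_monom scale y n)
    = laurent_monom scale (mul x y) (m + n)"
  unfolding laurent_mul_def laurent_monom_eq_single
  by (rule laurent_extend_single) (simp_all add: mul_simps)

lemma laurent_bracket_monom:
  "laurent_bracket scale mul (laurent_monom scale x m) (laurent_monom scale y n)
    = laurent_scale scale (of_int m) (laurent_monom scale (mul x y) (m + n - 1))
      - laurent_scale scale (of_int n) (laurent_monom scale (mul y x) (m + n - 1))"
proof -
  have "laurent_scale scale c 0 = 0" for c
    by (rule poly_mapping_eqI) simp
  then show ?thesis
    unfolding laurent_bracket_def laurent_monom_eq_single
    by (intro laurent_extend_single) (simp_all add: mul_simps)
qed

lemma bilinear_laurent_mul:
  "bilinear_map (laurent_scale scale) (laurent_scale scale) (laurent_scale scale)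
    (laurent_mul scale mul)"
  unfolding laurent_mul_def
  by (rule laurent_extend_bilinear)
    (auto intro!: poly_mapping_eqI vector_space_axioms
      simp: laurent_monom_eq_single mul_simps lookup_add lookup_single when_def)

lemma bilinear_laurent_bracket:
  "bilinear_map (laurent_scale scale) (laurent_scale scale) (laurent_scale scale)
    (laurent_bracket scale mul)"
  unfolding laurent_bracket_def
  by (rule laurent_extend_bilinear)
    (auto intro!: poly_mapping_eqI vector_space_axioms
      simp: laurent_monom_eq_single mul_simps lookup_add lookup_minus lookup_single when_def
        scale_right_distrib scale_right_diff_distrib mult.commute)

end

end

theory Submission
  imports Defs
begin

text \<open>
  The bracket on \<open>A[t, t\<^sup>-\<^sup>1]\<close> is alternating for every bilinear \<open>\<star>\<close>. Every other identity of a
  transposed Poisson algebra says that some expression, additive in each argument, vanishes.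
  Such an expression vanishes as soon as it does so on monomials
  \<open>x t\<^sup>m\<close>, and on monomials it is again a monomial, whose coefficient is a polynomial in the
  exponents \<open>m, n, p\<close> with values in \<open>A\<close>. The axioms of a transposed Novikov-Poisson algebra
  are exactly what makes these polynomials vanish identically:

  \<^item> the Jacobi sum of \<open>x t\<^sup>m, y t\<^sup>n, z t\<^sup>p\<close> (\<open>jacobiator_monom\<close>) has the defects of
    left symmetry at \<open>m n\<close>, \<open>n p\<close>, \<open>p m\<close> and the defects of right commutativity at
    \<open>m (m - 1)\<close>, \<open>n (n - 1)\<close>, \<open>p (p - 1)\<close>;
  \<^item> the transposed Leibniz rule (\<open>leibniz_defect_monom\<close>) is linear in the exponents: those of the
    two bracketed monomials carry the defect of the transposed Leibniz rule of \<open>A\<close>, and that of the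
    multiplier carries the defect of \<open>(z \<cdot> x) \<star> y = (z \<cdot> y) \<star> x\<close>.

  Conversely, small exponents isolate a single defect, up to the factor 2 in one case, which
  is invertible in characteristic 0. The multiplication of Laurent polynomials inherits
  commutativity and associativity from \<open>A\<close>, and the constant monomials give both back.
\<close>

section \<open>Identities on finitely supported functions\<close>

text \<open>
  A finitely supported function is the sum of its monomials. Hence an identity between
  multiadditive expressions, written as the vanishing of their difference, need only be checked
  on monomials, one argument at a time.
\<close>

lemma additive_eq_zero_if_single:
  fixes H :: "('i \<Rightarrow>\<^sub>0 'a::ab_group_add) \<Rightarrow> 'b::ab_group_add"
  assumes add: "\<And>f g. H (f + g) = H f + H g"
    and single: "\<And>m x. H (Poly_Mapping.single m x) = 0"
  shows "H f = 0"
proof -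
  have zero: "H 0 = 0" using add[of 0 0] by simp
  have "f = (\<Sum>m\<in>Poly_Mapping.keys f. Poly_Mapping.single m (Poly_Mapping.lookup f m))"
    by (rule poly_mapping_eqI) (auto simp: lookup_sum lookup_single when_def in_keys_iff)
  moreover have "H (\<Sum>m\<in>S. Poly_Mapping.single m (Poly_Mapping.lookup f m)) = 0" for S
    by (induction S rule: infinite_finite_induct) (simp_all add: zero add single)
  ultimately show ?thesis by metis
qed

lemma biadditive_eq_zero_if_single:
  fixes B :: "('i \<Rightarrow>\<^sub>0 'a::ab_group_add) \<Rightarrow> ('i \<Rightarrow>\<^sub>0 'a) \<Rightarrow> 'b::ab_group_add"
  assumes "\<And>f f' g. B (f + f') g = B f g + B f' g"
    and "\<And>f g g'. B f (g + g') = B f g + B f g'"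
    and "\<And>m x n y. B (Poly_Mapping.single m x) (Poly_Mapping.single n y) = 0"
  shows "B f g = 0"
proof (rule additive_eq_zero_if_single[where H = "\<lambda>f. B f g"])
  show "B (Poly_Mapping.single m x) g = 0" for m x
    by (rule additive_eq_zero_if_single) (simp_all add: assms)
qed (rule assms)

lemma triadditive_eq_zero_if_single:
  fixes T :: "('i \<Rightarrow>\<^sub>0 'a::ab_group_add) \<Rightarrow> ('i \<Rightarrow>\<^sub>0 'a) \<Rightarrow> ('i \<Rightarrow>\<^sub>0 'a) \<Rightarrow> 'b::ab_group_add"
  assumes "\<And>f f' g h. T (f + f') g h = T f g h + T f' g h"
    and "\<And>f g g' h. T f (g + g') h = T f g h + T f g' h"
    and "\<And>f g h h'. T f g (h + h') = T f g h + T f g h'"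
    and "\<And>m x n y p z. T (Poly_Mapping.single m x) (Poly_Mapping.single n y)
      (Poly_Mapping.single p z) = 0"
  shows "T f g h = 0"
proof (rule additive_eq_zero_if_single[where H = "\<lambda>f. T f g h"])
  show "T (Poly_Mapping.single m x) g h = 0" for m x
    by (rule biadditive_eq_zero_if_single) (simp_all add: assms)
qed (rule assms)

lemma single_eq_iffs [simp]:
  "Poly_Mapping.single k a = Poly_Mapping.single k b \<longleftrightarrow> a = b"
  "Poly_Mapping.single k a = 0 \<longleftrightarrow> a = 0"
  by (metis lookup_single_eq, metis lookup_single_eq lookup_zero single_zero)

section \<open>The products of Laurent monomials\<close>

text \<open>
  The two bilinear products need not satisfy any identities, so that each axiom can be
  compared with its counterpart on Laurent polynomials separately.
\<close>

locale two_products = vector_space scale + mul: k_algebra scale mul + circ: k_algebra scale circ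
  for scale :: "'k::field_char_0 \<Rightarrow> 'a::ab_group_add \<Rightarrow> 'a" (infixr \<open>*s\<close> 75)
    and mul :: "'a \<Rightarrow> 'a \<Rightarrow> 'a" (infixl \<open>\<cdot>\<close> 70)
    and circ :: "'a \<Rightarrow> 'a \<Rightarrow> 'a" (infixl \<open>\<star>\<close> 70)
begin

abbreviation lmul (infixl \<open>\<odot>\<close> 70) where "lmul \<equiv> laurent_mul scale mul"
abbreviation lbracket where "lbracket \<equiv> laurent_bracket scale circ"
abbreviation monom where "monom x m \<equiv> Poly_Mapping.single (m :: int) (x :: 'a)"

lemmas lmul_simps = bilinear_mapD[OF mul.bilinear_laurent_mul]
lemmas lbracket_simps = bilinear_mapD[OF circ.bilinear_laurent_bracket]

lemma laurent_scale_monom: "laurent_scale scale c (monom x m) = monom (c *s x) m"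
  by (rule poly_mapping_eqI) (simp add: lookup_single when_def)

lemma circ_diff: "(x - x') \<star> y = x \<star> y - x' \<star> y" "x \<star> (y - y') = x \<star> y - x \<star> y'"
  using circ.mul_simps(1)[of "x - x'" x' y] circ.mul_simps(2)[of x "y - y'" y']
  by (metis add_diff_cancel_right' diff_add_cancel)+

lemma lmul_monom: "monom x m \<odot> monom y n = monom (x \<cdot> y) (m + n)"
  using mul.laurent_mul_monom by (simp add: laurent_monom_eq_single)

lemma lbracket_monom:
  "lbracket (monom x m) (monom y n)
    = monom (of_int m *s (x \<star> y) - of_int n *s (y \<star> x)) (m + n - 1)"
  using circ.laurent_bracket_monom
  by (simp add: laurent_monom_eq_single laurent_scale_monom single_diff)

section \<open>The commutative associative product\<close>

lemma lmul_commute_iff: "(\<forall>f g. f \<odot> g = g \<odot> f) \<longleftrightarrow> (\<forall>x y. x \<cdot> y = y \<cdot> x)"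
proof
  assume l: "\<forall>f g. f \<odot> g = g \<odot> f"
  show "\<forall>x y. x \<cdot> y = y \<cdot> x"
  proof (intro allI)
    fix x y
    show "x \<cdot> y = y \<cdot> x"
      using l[rule_format, of "monom x 0" "monom y 0"] by (simp add: lmul_monom)
  qed
next
  assume c: "\<forall>x y. x \<cdot> y = y \<cdot> x"
  have "f \<odot> g - g \<odot> f = 0" for f g
  proof (rule biadditive_eq_zero_if_single[where B = "\<lambda>f g. f \<odot> g - g \<odot> f"])
    show "monom x m \<odot> monom y n - monom y n \<odot> monom x m = 0" for x m y n
      using c by (simp add: lmul_monom add.commute)
  qed (simp_all add: lmul_simps algebra_simps)
  then show "\<forall>f g. f \<odot> g = g \<odot> f" by simp
qed

lemma lmul_assoc_iff:
  "(\<forall>f g h. (f \<odot> g) \<odot> h = f \<odot> (g \<odot> h)) \<longleftrightarrow> (\<forall>x y z. (x \<cdot> y) \<cdot> z = x \<cdot> (y \<cdot> z))"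
proof
  assume l: "\<forall>f g h. (f \<odot> g) \<odot> h = f \<odot> (g \<odot> h)"
  show "\<forall>x y z. (x \<cdot> y) \<cdot> z = x \<cdot> (y \<cdot> z)"
  proof (intro allI)
    fix x y z
    show "(x \<cdot> y) \<cdot> z = x \<cdot> (y \<cdot> z)"
      using l[rule_format, of "monom x 0" "monom y 0" "monom z 0"] by (simp add: lmul_monom)
  qed
next
  assume a: "\<forall>x y z. (x \<cdot> y) \<cdot> z = x \<cdot> (y \<cdot> z)"
  have "(f \<odot> g) \<odot> h - f \<odot> (g \<odot> h) = 0" for f g h
  proof (rule triadditive_eq_zero_if_single[where T = "\<lambda>f g h. (f \<odot> g) \<odot> h - f \<odot> (g \<odot> h)"])
    show "(monom x m \<odot> monom y n) \<odot> monom z p - monom x m \<odot> (monom y n \<odot> monom z p) = 0" for x m y n z p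
      using a by (simp add: lmul_monom add.assoc)
  qed (simp_all add: lmul_simps algebra_simps)
  then show "\<forall>f g h. (f \<odot> g) \<odot> h = f \<odot> (g \<odot> h)" by simp
qed

section \<open>The Lie bracket\<close>

text \<open>
  Exchanging the two monomials exchanges the two terms of the bracket, up to sign. This gives
  antisymmetry, hence \<open>2 [f, f] = 0\<close>, and 2 can be cancelled.
\<close>

lemma lbracket_alternating: "lbracket f f = 0"
proof -
  have "lbracket f g + lbracket g f = 0" for f g
  proof (rule biadditive_eq_zero_if_single[where B = "\<lambda>f g. lbracket f g + lbracket g f"])
    show "lbracket (monom x m) (monom y n) + lbracket (monom y n) (monom x m) = 0" for x m y n
      by (simp add: lbracket_monom add.commute[of n m] flip: single_add)
  qed (simp_all add: lbracket_simps algebra_simps)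
  then have double: "lbracket f f + lbracket f f = 0" .
  show ?thesis
  proof (rule poly_mapping_eqI)
    fix k
    define c where "c = Poly_Mapping.lookup (lbracket f f) k"
    have "(2 :: 'k) *s c = c + c"
      using scale_left_distrib[of 1 1 c] by simp
    also have "\<dots> = 0"
      using double by (metis c_def lookup_add lookup_zero)
    finally show "Poly_Mapping.lookup (lbracket f f) k = Poly_Mapping.lookup 0 k"
      by (simp add: c_def)
  qed
qed

definition jacobiator where
  "jacobiator f g h = lbracket f (lbracket g h) + lbracket g (lbracket h f) + lbracket h (lbracket f g)"

definition right_commutator where
  "right_commutator x y z = (x \<star> y) \<star> z - (x \<star> z) \<star> y"

definition left_symmetrizer where
  "left_symmetrizer x y z = x \<star> (y \<star> z) - y \<star> (x \<star> z) - (x \<star> y) \<star> z + (y \<star> x) \<star> z"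

lemma lbracket_lbracket_monom:
  "lbracket (monom x m) (lbracket (monom y n) (monom z p))
    = monom ((of_int m * of_int n) *s (x \<star> (y \<star> z)) - (of_int m * of_int p) *s (x \<star> (z \<star> y))
        - (of_int (n + p - 1) * of_int n) *s ((y \<star> z) \<star> x)
        + (of_int (n + p - 1) * of_int p) *s ((z \<star> y) \<star> x)) (m + n + p - 2)"
  by (simp add: lbracket_monom circ_diff circ.mul_simps algebra_simps
      del: of_int_add of_int_diff)

text \<open>
  In \<open>[x t\<^sup>m, [y t\<^sup>n, z t\<^sup>p]]\<close> the outer bracket contributes the exponent \<open>n + p - 1\<close>, so the products
  \<open>(y \<star> z) \<star> x\<close> and \<open>(z \<star> y) \<star> x\<close> occur with \<open>n p\<close> and with \<open>n (n - 1)\<close> or \<open>p (p - 1)\<close>.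
  Summing cyclically, the former complete the products \<open>y \<star> (z \<star> x)\<close> and \<open>z \<star> (y \<star> x)\<close> to the
  defect of left symmetry, and the latter pair up to defects of right commutativity.
\<close>

lemma jacobiator_monom:
  "jacobiator (monom x m) (monom y n) (monom z p) =
    monom ((of_int m * of_int n) *s left_symmetrizer x y z
      + (of_int n * of_int p) *s left_symmetrizer y z x
      + (of_int p * of_int m) *s left_symmetrizer z x y
      + (of_int m * of_int (m - 1)) *s right_commutator x z y
      + (of_int n * of_int (n - 1)) *s right_commutator y x z
      + (of_int p * of_int (p - 1)) *s right_commutator z y x) (m + n + p - 2)"
proof -
  have e: "n + p + m - 2 = m + n + p - 2" "p + m + n - 2 = m + n + p - 2" by simp_all
  show ?thesis
    unfolding jacobiator_def lbracket_lbracket_monom e left_symmetrizer_def right_commutator_def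
    by (simp flip: single_add) (simp add: algebra_simps)
qed

text \<open>
  The exponents \<open>0, 0, 2\<close> leave only the term with \<open>p (p - 1) = 2\<close>, and \<open>1, 1, 0\<close> only the
  one with \<open>m n = 1\<close>.
\<close>

lemma jacobi_iff_novikov:
  "(\<forall>f g h. jacobiator f g h = 0) \<longleftrightarrow>
    (\<forall>x y z. right_commutator x y z = 0 \<and> left_symmetrizer x y z = 0)"
proof
  assume jac: "\<forall>f g h. jacobiator f g h = 0"
  show "\<forall>x y z. right_commutator x y z = 0 \<and> left_symmetrizer x y z = 0"
  proof (intro allI conjI)
    fix x y z
    show "right_commutator x y z = 0"
      using jac jacobiator_monom[where x=z and m=0 and y=y and n=0 and z=x and p=2] by simp
    show "left_symmetrizer x y z = 0"
      using jac jacobiator_monom[where x=x and m=1 and y=y and n=1 and z=z and p=0] by simp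
  qed
next
  assume nov: "\<forall>x y z. right_commutator x y z = 0 \<and> left_symmetrizer x y z = 0"
  have "jacobiator f g h = 0" for f g h
  proof (rule triadditive_eq_zero_if_single[where T = jacobiator])
    show "jacobiator (monom x m) (monom y n) (monom z p) = 0" for x m y n z p
      using nov by (simp add: jacobiator_monom)
  qed (simp_all add: jacobiator_def lbracket_simps algebra_simps)
  then show "\<forall>f g h. jacobiator f g h = 0" by simp
qed

section \<open>The transposed Leibniz rule\<close>

definition leibniz_defect where
  "leibniz_defect h f g
    = laurent_scale scale 2 (h \<odot> lbracket f g) - lbracket (h \<odot> f) g - lbracket f (h \<odot> g)"

definition circ_leibniz_defect where
  "circ_leibniz_defect z x y = 2 *s (z \<cdot> (x \<star> y)) - (z \<cdot> x) \<star> y - x \<star> (z \<cdot> y)"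

lemma leibniz_defect_monom:
  "leibniz_defect (monom z p) (monom x m) (monom y n) =
    monom (of_int m *s circ_leibniz_defect z x y - of_int n *s circ_leibniz_defect z y x
      - of_int p *s ((z \<cdot> x) \<star> y - (z \<cdot> y) \<star> x)) (m + n + p - 1)"
proof -
  have mul_diff: "z \<cdot> (u - v) = z \<cdot> u - z \<cdot> v" for u v
    using mul.mul_simps(2)[of z "u - v" v] by simp
  have e: "p + (m + n - 1) = m + n + p - 1" "p + m + n - 1 = m + n + p - 1"
    "m + (p + n) - 1 = m + n + p - 1" by simp_all
  show ?thesis
    unfolding leibniz_defect_def circ_leibniz_defect_def lbracket_monom lmul_monom
      laurent_scale_monom e
    by (simp add: mul_diff mul.mul_simps flip: single_diff) (simp add: algebra_simps)
qed

text \<open>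
  The coefficient is linear in the exponents, so setting one of them to 1 and the
  others to 0 isolates each defect.
\<close>

lemma leibniz_iff:
  "(\<forall>h f g. leibniz_defect h f g = 0) \<longleftrightarrow>
    (\<forall>x y z. (z \<cdot> x) \<star> y = (z \<cdot> y) \<star> x \<and> circ_leibniz_defect z x y = 0)"
proof
  assume leib: "\<forall>h f g. leibniz_defect h f g = 0"
  show "\<forall>x y z. (z \<cdot> x) \<star> y = (z \<cdot> y) \<star> x \<and> circ_leibniz_defect z x y = 0"
  proof (intro allI conjI)
    fix x y z
    show "(z \<cdot> x) \<star> y = (z \<cdot> y) \<star> x"
      using leib leibniz_defect_monom[where z=z and p=1 and x=x and m=0 and y=y and n=0] by simp
    show "circ_leibniz_defect z x y = 0"
      using leib leibniz_defect_monom[where z=z and p=0 and x=x and m=1 and y=y and n=0] by simp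
  qed
next
  assume r: "\<forall>x y z. (z \<cdot> x) \<star> y = (z \<cdot> y) \<star> x \<and> circ_leibniz_defect z x y = 0"
  interpret L: vector_space "laurent_scale scale" by (rule vector_space_laurent_scale)
  have "leibniz_defect h f g = 0" for h f g
  proof (rule triadditive_eq_zero_if_single[where T = leibniz_defect])
    show "leibniz_defect (monom z p) (monom x m) (monom y n) = 0" for z p x m y n
      using r by (simp add: leibniz_defect_monom)
  qed (simp_all add: leibniz_defect_def lbracket_simps lmul_simps L.scale_right_distrib algebra_simps)
  then show "\<forall>h f g. leibniz_defect h f g = 0" by simp
qed

section \<open>The equivalence\<close>

lemma transposed_poisson_iff_laurent_identities:
  "transposed_poisson_algebra (laurent_scale scale) lmul lbracket \<longleftrightarrow>
    (\<forall>f g. f \<odot> g = g \<odot> f) \<and> (\<forall>f g h. (f \<odot> g) \<odot> h = f \<odot> (g \<odot> h)) \<and>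
    (\<forall>f g h. jacobiator f g h = 0) \<and> (\<forall>h f g. leibniz_defect h f g = 0)"
  unfolding transposed_poisson_algebra_def comm_assoc_algebra_def lie_algebra_def k_algebra_def
    transposed_poisson_algebra_axioms_def comm_assoc_algebra_axioms_def lie_algebra_axioms_def
    k_algebra_axioms_def jacobiator_def leibniz_defect_def
  using vector_space_laurent_scale mul.bilinear_laurent_mul circ.bilinear_laurent_bracket
    lbracket_alternating
  by (auto simp: diff_diff_eq)

lemma transposed_novikov_poisson_iff_identities:
  "transposed_novikov_poisson_algebra scale mul circ \<longleftrightarrow>
    (\<forall>x y. x \<cdot> y = y \<cdot> x) \<and> (\<forall>x y z. (x \<cdot> y) \<cdot> z = x \<cdot> (y \<cdot> z)) \<and>
    (\<forall>x y z. right_commutator x y z = 0 \<and> left_symmetrizer x y z = 0) \<and>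
    (\<forall>x y z. (z \<cdot> x) \<star> y = (z \<cdot> y) \<star> x \<and> circ_leibniz_defect z x y = 0)"
proof -
  have ls: "left_symmetrizer x y z = 0 \<longleftrightarrow>
      (x \<star> y) \<star> z - x \<star> (y \<star> z) = (y \<star> x) \<star> z - y \<star> (x \<star> z)" for x y z
    unfolding left_symmetrizer_def by (auto simp: algebra_simps)
  have cl: "circ_leibniz_defect z x y = 0 \<longleftrightarrow>
      2 *s (z \<cdot> (x \<star> y)) = (z \<cdot> x) \<star> y + x \<star> (z \<cdot> y)" for x y z
    by (simp add: circ_leibniz_defect_def diff_diff_eq)
  show ?thesis
    unfolding transposed_novikov_poisson_algebra_def comm_assoc_algebra_def novikov_algebra_def
      transposed_novikov_poisson_algebra_axioms_def comm_assoc_algebra_axioms_def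
      novikov_algebra_axioms_def ls cl right_commutator_def
    using mul.k_algebra_axioms circ.k_algebra_axioms by auto
qed

end

theorem theorem2p3:
  fixes scale :: "'k::field_char_0 \<Rightarrow> 'a::ab_group_add \<Rightarrow> 'a"
    and mul circ :: "'a \<Rightarrow> 'a \<Rightarrow> 'a"
  assumes "vector_space scale"
    and "bilinear_map scale scale scale mul"
    and "bilinear_map scale scale scale circ"
  shows "transposed_poisson_algebra (laurent_scale scale)
      (laurent_mul scale mul) (laurent_bracket scale circ)
    \<longleftrightarrow> transposed_novikov_poisson_algebra scale mul circ"
proof -
  interpret two_products scale mul circ
    using assms by (simp add: two_products_def k_algebra_def k_algebra_axioms_def)
  show ?thesis
    unfolding transposed_poisson_iff_laurent_identities transposed_novikov_poisson_iff_identities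
      lmul_commute_iff lmul_assoc_iff jacobi_iff_novikov leibniz_iff ..
qed

end
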